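(* Let $M$ be a binary matroid on ground set $V$. (1) $M$ is bipartite iff $M+V$ is an even $\Delta$-matroid. (2) $M$ is Eulerian iff $M\bar{*}V$ is an even $\Delta$-matroid.
   Context: A matroid is bipartite if every circuit has even cardinality, and Eulerian if $V$ is a disjoint union of circuits. The matroid $M$ is identified with the set system $(V,\mathcal{B})$ of its bases. For a set system $N=(V,D)$ and $X\subseteq V$: loop complementation $N+X=(V,D')$ with $Y\in D'$ iff the number of $W\in D$ with $Y\setminus X\subseteq W\subseteq Y$ is odd; dual pivot $N\bar{*}X=(V,D'')$ with $Y\in D''$ iff the number of $W\in D$ with $Y\subseteq W\subseteq Y\cup X$ is odd. A set system is even if all its members have cardinalities of the same parity. A $\Delta$-matroid is a nonempty-family set system such that for all $X,Y\in D$, $x\in X\triangle Y$ there is $y\in X\triangle Y$ (possibly $y=x$) with $X\triangle\{x,y\}\in D$. *)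

theory Defs
  imports Main "HOL-Library.Z2"
begin

text \<open>A set system \<open>(V, D)\<close> is a pair of a finite ground set \<open>V\<close> and a family \<open>D\<close> of
  subsets of \<open>V\<close>.\<close>

type_synonym 'a set_system = "'a set \<times> 'a set set"

abbreviation ground :: "'a set_system \<Rightarrow> 'a set" where
  "ground N \<equiv> fst N"

abbreviation family :: "'a set_system \<Rightarrow> 'a set set" where
  "family N \<equiv> snd N"

definition set_system :: "'a set_system \<Rightarrow> bool" where
  "set_system N \<longleftrightarrow> finite (ground N) \<and> family N \<subseteq> Pow (ground N)"

definition loop_complement :: "'a set_system \<Rightarrow> 'a set \<Rightarrow> 'a set_system" where
  "loop_complement N X =
     (ground N, {Y. Y \<subseteq> ground N \<and> odd (card {W \<in> family N. Y - X \<subseteq> W \<and> W \<subseteq> Y})})"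

definition dual_pivot :: "'a set_system \<Rightarrow> 'a set \<Rightarrow> 'a set_system" where
  "dual_pivot N X =
     (ground N, {Y. Y \<subseteq> ground N \<and> odd (card {W \<in> family N. Y \<subseteq> W \<and> W \<subseteq> Y \<union> X})})"

definition even_set_system :: "'a set_system \<Rightarrow> bool" where
  "even_set_system N \<longleftrightarrow>
     (\<forall>X \<in> family N. \<forall>Y \<in> family N. even (card X) \<longleftrightarrow> even (card Y))"

definition delta_matroid :: "'a set_system \<Rightarrow> bool" where
  "delta_matroid N \<longleftrightarrow> set_system N \<and> family N \<noteq> {} \<and>
     (\<forall>X \<in> family N. \<forall>Y \<in> family N. \<forall>x \<in> sym_diff X Y.
        \<exists>y \<in> sym_diff X Y. sym_diff X {x, y} \<in> family N)"

text \<open>A matroid is identified with the set system of its bases.\<close>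

definition matroid :: "'a set_system \<Rightarrow> bool" where
  "matroid M \<longleftrightarrow> set_system M \<and> family M \<noteq> {} \<and>
     (\<forall>B \<in> family M. \<forall>B' \<in> family M. \<forall>x \<in> B - B'.
        \<exists>y \<in> B' - B. insert y (B - {x}) \<in> family M)"

definition indep :: "'a set_system \<Rightarrow> 'a set \<Rightarrow> bool" where
  "indep M X \<longleftrightarrow> (\<exists>B \<in> family M. X \<subseteq> B)"

definition circuit :: "'a set_system \<Rightarrow> 'a set \<Rightarrow> bool" where
  "circuit M C \<longleftrightarrow> C \<subseteq> ground M \<and> \<not> indep M C \<and> (\<forall>X. X \<subset> C \<longrightarrow> indep M X)"

text \<open>\<open>A\<close> is a matrix over \<open>GF(2)\<close> with rows \<open>0, \<dots>, r - 1\<close> and columns indexed by the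
  elements of the ground set. The columns indexed by \<open>X\<close> are linearly independent as a family,
  so two equal columns with distinct indices count as dependent.\<close>

definition columns_lin_indep :: "nat \<Rightarrow> (nat \<Rightarrow> 'a \<Rightarrow> bit) \<Rightarrow> 'a set \<Rightarrow> bool" where
  "columns_lin_indep r A X \<longleftrightarrow>
     (\<forall>c. (\<forall>i<r. (\<Sum>v\<in>X. c v * A i v) = 0) \<longrightarrow> (\<forall>v\<in>X. c v = 0))"

definition binary_matroid :: "'a set_system \<Rightarrow> bool" where
  "binary_matroid M \<longleftrightarrow> matroid M \<and>
     (\<exists>r A. \<forall>X. X \<subseteq> ground M \<longrightarrow> (indep M X \<longleftrightarrow> columns_lin_indep r A X))"

definition bipartite_matroid :: "'a set_system \<Rightarrow> bool" where
  "bipartite_matroid M \<longleftrightarrow> (\<forall>C. circuit M C \<longrightarrow> even (card C))"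

definition eulerian_matroid :: "'a set_system \<Rightarrow> bool" where
  "eulerian_matroid M \<longleftrightarrow>
     (\<exists>\<C>. (\<forall>C \<in> \<C>. circuit M C) \<and> pairwise disjnt \<C> \<and> \<Union>\<C> = ground M)"

end

theory Submission
  imports Defs
begin

text \<open>
  Let \<open>Z\<close> and \<open>R\<close> be the cycle space and the cocycle space of \<open>M\<close>, two orthogonal subspaces of
  \<open>GF(2)\<^sup>V\<close> of complementary dimension. Attach to every element \<open>v\<close> one of the three lines
  \<open>D\<^sub>v = 0\<close>, \<open>C\<^sub>v = 0\<close>, \<open>C\<^sub>v = D\<^sub>v\<close> of \<open>GF(2)\<^sup>2\<close>, and call such a choice free if only the zero pair
  \<open>(C, D) \<in> Z \<times> R\<close> obeys it at every element. Bases correspond to the free choices that use the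
  first line on the set and the second line outside of it. If the choice is fixed away from \<open>v\<close>,
  then none or exactly two of the three possible lines at \<open>v\<close> make it free; hence the parity count
  that defines \<open>M + V\<close> amounts to replacing the first line by the third. Isotropy of \<open>Z \<times> R\<close> gives
  the symmetric exchange property, and two members that differ in one element come from a pair
  \<open>(C, D)\<close> for which \<open>C - D\<close> is a singleton. As \<open>C \<inter> D\<close> is even, \<open>M + V\<close> is even iff all members
  of \<open>Z\<close> are even, that is, iff \<open>M\<close> is bipartite. Exchanging \<open>Z\<close> and \<open>R\<close> and complementing gives the
  dual pivot: it is even iff all members of \<open>R\<close> are even, that is, iff \<open>V \<in> Z\<close>.
\<close>

section \<open>Symmetric differences\<close>

lemma even_card_sym_diff:
  assumes "finite A" "finite B"
  shows "even (card (sym_diff A B)) \<longleftrightarrow> (even (card A) \<longleftrightarrow> even (card B))"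
proof -
  have "card (sym_diff A B) = card (A - B) + card (B - A)"
    using assms by (intro card_Un_disjoint) auto
  moreover have "card A = card (A - B) + card (A \<inter> B)"
    using assms by (subst card_Un_disjoint[symmetric]) (auto intro: arg_cong[where f = card])
  moreover have "card B = card (B - A) + card (A \<inter> B)"
    using assms by (subst card_Un_disjoint[symmetric]) (auto intro: arg_cong[where f = card])
  ultimately show ?thesis by presburger
qed

lemma sum_bit_sym_diff:
  fixes f :: "'a \<Rightarrow> bit"
  assumes "finite A" "finite B"
  shows "sum f (sym_diff A B) = sum f A + sum f B"
proof -
  have "sum f (sym_diff A B) = sum f (A - B) + sum f (B - A)"
    using assms by (intro sum.union_disjoint) auto
  moreover have "sum f A = sum f (A \<inter> B) + sum f (A - B)"
    using assms by (intro sum.Int_Diff)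
  moreover have "sum f B = sum f (A \<inter> B) + sum f (B - A)"
    using assms sum.Int_Diff[of B f A] by (simp add: Int_commute)
  moreover have "i + a + (i + b) = a + b" for i a b :: bit
    by (cases i; cases a; cases b) simp_all
  ultimately show ?thesis by metis
qed

text \<open>Intersecting with \<open>T\<close> is linear over GF(2), so the traces fill
  \<open>Pow T\<close> as soon as they contain every singleton.\<close>

lemma sym_diff_closed_trace:
  assumes "finite T" "{} \<in> Z" "\<And>A B. A \<in> Z \<Longrightarrow> B \<in> Z \<Longrightarrow> sym_diff A B \<in> Z"
    and "\<And>v. v \<in> T \<Longrightarrow> \<exists>C\<in>Z. C \<inter> T = {v}" and "S \<subseteq> T"
  shows "\<exists>C\<in>Z. C \<inter> T = S"
proof -
  have "finite S" using assms(1,5) finite_subset by blast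
  then show ?thesis using assms(5)
  proof (induction S)
    case empty
    then show ?case using assms(2) by auto
  next
    case (insert v S)
    then obtain C where C: "C \<in> Z" "C \<inter> T = S" by auto
    obtain C' where C': "C' \<in> Z" "C' \<inter> T = {v}" using assms(4) insert.prems by blast
    have "sym_diff C C' \<inter> T = sym_diff (C \<inter> T) (C' \<inter> T)" by blast
    then have "sym_diff C C' \<inter> T = insert v S" unfolding C(2) C'(2) using insert.hyps by auto
    then show ?case using assms(3)[OF C(1) C'(1)] by blast
  qed
qed

text \<open>Takes the place of a dimension count: a space that maps onto all subsets of
  \<open>T\<close> has at least that many members.\<close>

lemma card_trace_ge:
  assumes "finite Z" "finite T" "\<And>S. S \<subseteq> T \<Longrightarrow> \<exists>C\<in>Z. C \<inter> T = S"
  shows "2 ^ card T \<le> card Z"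
proof -
  have "Pow T \<subseteq> (\<lambda>C. C \<inter> T) ` Z" using assms(3) by blast
  then have "card (Pow T) \<le> card Z" by (rule surj_card_le[OF assms(1)])
  then show ?thesis using assms(2) by (simp add: card_Pow)
qed

section \<open>Pairs of orthogonal subspaces\<close>

datatype line = First | Second | Third

fun on_line :: "line \<Rightarrow> bool \<Rightarrow> bool \<Rightarrow> bool" where
  "on_line First c d \<longleftrightarrow> \<not> d"
| "on_line Second c d \<longleftrightarrow> \<not> c"
| "on_line Third c d \<longleftrightarrow> c = d"

lemma on_line_False [simp]: "on_line l False False"
  by (cases l) auto

lemma on_line_sym_diff:
  "on_line l (v \<in> C) (v \<in> D) \<Longrightarrow> on_line l (v \<in> C') (v \<in> D') \<Longrightarrow>
    on_line l (v \<in> sym_diff C C') (v \<in> sym_diff D D')"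
  by (cases l) auto

text \<open>A line has only one nonzero vector, so the alternating form \<open>c d' + c' d\<close>
  vanishes on it.\<close>

lemma on_line_isotropic:
  "on_line l c d \<Longrightarrow> on_line l c' d' \<Longrightarrow> (c \<and> d') = (c' \<and> d)"
  by (cases l) auto

text \<open>By \<open>orth\<close>, the space \<open>Z \<times> R\<close> is isotropic for the sum
  over \<open>V\<close> of the alternating forms; \<open>card_prod\<close> makes it maximal. The
  reverse inequality is a consequence of orthogonality.\<close>

locale orthogonal_pair =
  fixes V :: "'a set" and Z R :: "'a set set"
  assumes fin: "finite V"
    and Z_sub: "Z \<subseteq> Pow V" and R_sub: "R \<subseteq> Pow V"
    and Z_empty: "{} \<in> Z" and R_empty: "{} \<in> R"
    and Z_sym_diff: "A \<in> Z \<Longrightarrow> B \<in> Z \<Longrightarrow> sym_diff A B \<in> Z"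
    and R_sym_diff: "A \<in> R \<Longrightarrow> B \<in> R \<Longrightarrow> sym_diff A B \<in> R"
    and orth: "C \<in> Z \<Longrightarrow> D \<in> R \<Longrightarrow> even (card (C \<inter> D))"
    and card_prod: "2 ^ card V \<le> card Z * card R"
begin

lemma finite_Z: "C \<in> Z \<Longrightarrow> finite C" and finite_R: "D \<in> R \<Longrightarrow> finite D"
  using Z_sub R_sub fin by (auto intro: finite_subset)

section \<open>Free choices of lines\<close>

definition free :: "('a \<Rightarrow> line) \<Rightarrow> bool" where
  "free t \<longleftrightarrow> (\<forall>C\<in>Z. \<forall>D\<in>R. (\<forall>v\<in>V. on_line (t v) (v \<in> C) (v \<in> D)) \<longrightarrow> C = {} \<and> D = {})"

text \<open>The two conditions say that the pair lies on \<open>Second\<close> outside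
  \<open>W\<close> and on \<open>First\<close> inside. For the cycle and cocycle spaces of a binary
  matroid these sets are the bases, see \<open>family_eq_bases\<close>.\<close>

definition bases :: "'a set set" where
  "bases = {W. W \<subseteq> V \<and> (\<forall>C\<in>Z. \<forall>D\<in>R. C \<subseteq> W \<and> D \<inter> W = {} \<longrightarrow> C = {} \<and> D = {})}"

text \<open>Loop complementation by the whole ground set: the lower bound \<open>Y - V\<close> on
  \<open>W\<close> is empty and disappears.\<close>

definition odd_sets :: "'a set set" where
  "odd_sets = {Y. Y \<subseteq> V \<and> odd (card {W \<in> bases. W \<subseteq> Y})}"

lemma freeD:
  "free t \<Longrightarrow> C \<in> Z \<Longrightarrow> D \<in> R \<Longrightarrow> (\<And>v. v \<in> V \<Longrightarrow> on_line (t v) (v \<in> C) (v \<in> D)) \<Longrightarrow>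
    C = {} \<and> D = {}"
  unfolding free_def by blast

lemma not_freeE:
  assumes "\<not> free t"
  obtains C D where "C \<in> Z" "D \<in> R" "\<And>v. v \<in> V \<Longrightarrow> on_line (t v) (v \<in> C) (v \<in> D)"
    "\<not> (C = {} \<and> D = {})"
  using assms unfolding free_def by blast

lemma free_cong: "(\<And>v. v \<in> V \<Longrightarrow> t v = t' v) \<Longrightarrow> free t = free t'"
  unfolding free_def by simp

text \<open>The alternating forms of two members of \<open>Z \<times> R\<close> sum over
  \<open>V\<close> to the parity of \<open>card (C \<inter> D') + card (C' \<inter> D)\<close>,
  which is even. A sum with at most one nonzero term then has none.\<close>

lemma isotropic_at:
  assumes "C \<in> Z" "D \<in> R" "C' \<in> Z" "D' \<in> R"
    and "\<And>v. v \<in> V \<Longrightarrow> v \<noteq> x \<Longrightarrow> (v \<in> C \<and> v \<in> D') = (v \<in> C' \<and> v \<in> D)"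
  shows "(x \<in> C \<and> x \<in> D') = (x \<in> C' \<and> x \<in> D)"
proof (rule ccontr)
  assume "\<not> ?thesis"
  moreover have "C \<subseteq> V" "D \<subseteq> V" "C' \<subseteq> V" "D' \<subseteq> V" using assms(1-4) Z_sub R_sub by auto
  ultimately have "sym_diff (C \<inter> D') (C' \<inter> D) = {x}" using assms(5) by blast
  moreover have "even (card (sym_diff (C \<inter> D') (C' \<inter> D)))"
    using orth[OF assms(1,4)] orth[OF assms(3,2)] finite_Z[OF assms(1)] finite_Z[OF assms(3)]
    by (subst even_card_sym_diff) auto
  ultimately show False by simp
qed

text \<open>Dropping the condition at \<open>x\<close> leaves \<open>card V - 1\<close> linear
  conditions on a space with at least \<open>2 ^ card V\<close> members, so a nonzero solution
  remains. The pigeonhole principle replaces linear algebra.\<close>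

lemma near_element:
  assumes "x \<in> V"
  obtains C D where "C \<in> Z" "D \<in> R" "\<not> (C = {} \<and> D = {})"
    "\<And>v. v \<in> V \<Longrightarrow> v \<noteq> x \<Longrightarrow> on_line (t v) (v \<in> C) (v \<in> D)"
proof -
  \<comment> \<open>\<open>f\<close> records, for each element other than \<open>x\<close>, the
    class of the pair modulo the line \<open>t v\<close>.\<close>
  define f where "f = (\<lambda>(C, D). {v \<in> V - {x}. \<not> on_line (t v) (v \<in> C) (v \<in> D)})"
  have "f ` (Z \<times> R) \<subseteq> Pow (V - {x})" by (auto simp: f_def)
  then have "card (f ` (Z \<times> R)) \<le> card (Pow (V - {x}))" using fin by (intro card_mono) auto
  also have "\<dots> = 2 ^ (card V - 1)" using fin assms by (simp add: card_Pow)
  also have "\<dots> < 2 ^ card V"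
    using card_Diff1_less[OF fin assms] fin assms by (intro power_strict_increasing) auto
  also have "\<dots> \<le> card (Z \<times> R)" using card_prod by (simp add: card_cartesian_product)
  finally have "\<not> inj_on f (Z \<times> R)" by (rule pigeonhole)
  then obtain C D C' D' where CD: "C \<in> Z" "D \<in> R" "C' \<in> Z" "D' \<in> R" "(C, D) \<noteq> (C', D')"
    and eq: "f (C, D) = f (C', D')"
    unfolding inj_on_def by auto
  show ?thesis
  proof (rule that)
    show "sym_diff C C' \<in> Z" "sym_diff D D' \<in> R" using CD Z_sym_diff R_sym_diff by auto
    show "\<not> (sym_diff C C' = {} \<and> sym_diff D D' = {})" using CD(5) by auto
    fix v assume v: "v \<in> V" "v \<noteq> x"
    have "on_line (t v) (v \<in> C) (v \<in> D) = on_line (t v) (v \<in> C') (v \<in> D')"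
      using eq v unfolding f_def by auto
    \<comment> \<open>The plane modulo a line has two classes, so two vectors that are both off the
      line have their sum on it.\<close>
    then show "on_line (t v) (v \<in> sym_diff C C') (v \<in> sym_diff D D')"
      by (cases "t v") auto
  qed
qed

text \<open>If a nonzero pair obeys \<open>t\<close> away from \<open>x\<close> and vanishes at
  \<open>x\<close>, no line at \<open>x\<close> is free. Otherwise all nonzero pairs that obey
  \<open>t\<close> away from \<open>x\<close> have the same nonzero value there; exactly one line
  contains it, and the other two are free.\<close>

lemma three_lines:
  assumes "x \<in> V"
  shows "free (t(x := Third)) \<longleftrightarrow> free (t(x := First)) \<noteq> free (t(x := Second))"
proof -
  obtain C D where CD: "C \<in> Z" "D \<in> R" "\<not> (C = {} \<and> D = {})"
    "\<And>v. v \<in> V \<Longrightarrow> v \<noteq> x \<Longrightarrow> on_line (t v) (v \<in> C) (v \<in> D)"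
    using near_element[OF assms] by blast
  have on: "\<not> free (t(x := l))" if "C' \<in> Z" "D' \<in> R" "\<not> (C' = {} \<and> D' = {})"
    "\<And>v. v \<in> V \<Longrightarrow> v \<noteq> x \<Longrightarrow> on_line (t v) (v \<in> C') (v \<in> D')"
    "on_line l (x \<in> C') (x \<in> D')" for C' D' l
  proof
    assume "free (t(x := l))"
    moreover have "on_line ((t(x := l)) v) (v \<in> C') (v \<in> D')" if "v \<in> V" for v
      using \<open>on_line l (x \<in> C') (x \<in> D')\<close>
        \<open>\<And>v. v \<in> V \<Longrightarrow> v \<noteq> x \<Longrightarrow> on_line (t v) (v \<in> C') (v \<in> D')\<close>[OF that] by auto
    ultimately show False using freeD[of "t(x := l)" C' D'] that(1-3) by blast
  qed
  show ?thesis
  proof (cases "\<exists>C'\<in>Z. \<exists>D'\<in>R. \<not> (C' = {} \<and> D' = {}) \<and> x \<notin> C' \<and> x \<notin> D' \<and>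
      (\<forall>v\<in>V. v \<noteq> x \<longrightarrow> on_line (t v) (v \<in> C') (v \<in> D'))")
    case True
    then obtain C' D' where "C' \<in> Z" "D' \<in> R" "\<not> (C' = {} \<and> D' = {})" "x \<notin> C'" "x \<notin> D'"
      "\<And>v. v \<in> V \<Longrightarrow> v \<noteq> x \<Longrightarrow> on_line (t v) (v \<in> C') (v \<in> D')"
      by blast
    then have "\<not> free (t(x := l))" for l by (intro on) (cases l; auto)+
    then show ?thesis by simp
  next
    case False
    then have x: "x \<in> C \<or> x \<in> D" using CD by blast
    have eq: "free (t(x := l)) \<longleftrightarrow> \<not> on_line l (x \<in> C) (x \<in> D)" for l
    proof
      assume "free (t(x := l))"
      then show "\<not> on_line l (x \<in> C) (x \<in> D)" using on[OF CD] by blast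
    next
      assume l: "\<not> on_line l (x \<in> C) (x \<in> D)"
      show "free (t(x := l))"
      proof (rule ccontr)
        assume "\<not> free (t(x := l))"
        then obtain C' D' where CD': "C' \<in> Z" "D' \<in> R"
          "\<And>v. v \<in> V \<Longrightarrow> on_line ((t(x := l)) v) (v \<in> C') (v \<in> D')" "\<not> (C' = {} \<and> D' = {})"
          by (elim not_freeE) blast
        have off: "on_line (t v) (v \<in> C') (v \<in> D')" if "v \<in> V" "v \<noteq> x" for v
          using CD'(3)[OF that(1)] that(2) by simp
        have at: "on_line l (x \<in> C') (x \<in> D')" using CD'(3)[OF assms] by simp
        have "(x \<in> C \<and> x \<in> D') = (x \<in> C' \<and> x \<in> D)"
          by (rule isotropic_at[OF CD(1,2) CD'(1,2)]) (use CD(4) off on_line_isotropic in blast)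
        \<comment> \<open>The values of both pairs at \<open>x\<close> are proportional by isotropy.
          The line \<open>l\<close> contains the second value but not the first, so the second is
          zero.\<close>
        with l at have "x \<notin> C'" "x \<notin> D'" by (cases l; auto)+
        with False CD' off show False by blast
      qed
    qed
    show ?thesis unfolding eq using x by auto
  qed
qed

lemma free_First_Second_iff:
  assumes "S \<subseteq> V"
  shows "free (\<lambda>v. if v \<in> S then First else Second) \<longleftrightarrow> S \<in> bases"
proof -
  have "(\<forall>v\<in>V. on_line (if v \<in> S then First else Second) (v \<in> C) (v \<in> D)) \<longleftrightarrow>
    C \<subseteq> S \<and> D \<inter> S = {}" if "C \<in> Z" "D \<in> R" for C D
  proof -
    have "C \<subseteq> V" "D \<subseteq> V" using that Z_sub R_sub by auto
    then show ?thesis using assms by (auto split: if_splits)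
  qed
  then show ?thesis unfolding free_def bases_def using assms by auto
qed

lemma finite_bases: "finite bases"
  using fin by (auto simp: bases_def intro: finite_subset[of _ "Pow V"])

text \<open>Each \<open>Third\<close> is resolved by \<open>three_lines\<close> into
  \<open>First\<close>, which puts the element into \<open>W\<close>, and \<open>Second\<close>,
  which keeps it out. The exclusive or of the two cases is the parity of the sum of the two
  counts.\<close>

lemma free_iff_odd:
  assumes "finite U" "U \<subseteq> V" "S \<subseteq> V" "U \<inter> S = {}"
  shows "free (\<lambda>v. if v \<in> U then Third else if v \<in> S then First else Second) \<longleftrightarrow>
    odd (card {W \<in> bases. S \<subseteq> W \<and> W \<subseteq> S \<union> U})"
  using assms
proof (induction U arbitrary: S)
  case empty
  have "{W \<in> bases. S \<subseteq> W \<and> W \<subseteq> S \<union> {}} = (if S \<in> bases then {S} else {})" by auto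
  then show ?case using free_First_Second_iff[of S] empty by auto
next
  case (insert x U)
  let ?t = "\<lambda>v. if v \<in> U then Third else if v \<in> S then First else Second"
  let ?in = "{W \<in> bases. insert x S \<subseteq> W \<and> W \<subseteq> insert x S \<union> U}"
  let ?out = "{W \<in> bases. S \<subseteq> W \<and> W \<subseteq> S \<union> U}"
  have x: "x \<in> V" "x \<notin> U" "x \<notin> S" using insert by auto
  have "free (\<lambda>v. if v \<in> insert x U then Third else if v \<in> S then First else Second) =
      free (?t(x := Third))"
    by (rule free_cong) auto
  also have "\<dots> \<longleftrightarrow> free (?t(x := First)) \<noteq> free (?t(x := Second))"
    by (rule three_lines[OF x(1)])
  also have "free (?t(x := First)) =
      free (\<lambda>v. if v \<in> U then Third else if v \<in> insert x S then First else Second)"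
    using x by (intro free_cong) auto
  also have "\<dots> \<longleftrightarrow> odd (card ?in)" using insert by (intro insert.IH) auto
  also have "free (?t(x := Second)) = free ?t" using x by (intro free_cong) auto
  also have "\<dots> \<longleftrightarrow> odd (card ?out)" using insert by (intro insert.IH) auto
  also have "odd (card ?in) \<noteq> odd (card ?out) \<longleftrightarrow> odd (card ?in + card ?out)" by auto
  also have "card ?in + card ?out = card (?in \<union> ?out)"
    using finite_bases x by (intro card_Un_disjoint[symmetric]) auto
  also have "?in \<union> ?out = {W \<in> bases. S \<subseteq> W \<and> W \<subseteq> S \<union> insert x U}" using x by auto
  finally show ?case .
qed

section \<open>Symmetric exchange\<close>

abbreviation lines :: "'a set \<Rightarrow> 'a \<Rightarrow> line" where
  "lines Y v \<equiv> if v \<in> Y then Third else Second"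

lemma odd_sets_iff: "Y \<in> odd_sets \<longleftrightarrow> Y \<subseteq> V \<and> free (lines Y)"
proof (cases "Y \<subseteq> V")
  case True
  then have "finite Y" using fin finite_subset by blast
  then show ?thesis
    using free_iff_odd[of Y "{}"] True by (simp add: odd_sets_def cong: if_cong)
qed (simp add: odd_sets_def)

text \<open>\<open>Second\<close> outside \<open>B\<close> forces \<open>C \<subseteq> B\<close>,
  hence \<open>C = {}\<close>; then \<open>Third\<close> on \<open>B\<close> makes \<open>D\<close>
  avoid \<open>B\<close>. The inclusion supplies the nonempty family that a \<Delta>-matroid
  needs.\<close>

lemma bases_subset_odd_sets: "bases \<subseteq> odd_sets"
proof
  fix B assume "B \<in> bases"
  then have B: "B \<subseteq> V" "\<And>C D. C \<in> Z \<Longrightarrow> D \<in> R \<Longrightarrow> C \<subseteq> B \<Longrightarrow> D \<inter> B = {} \<Longrightarrow> C = {} \<and> D = {}"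
    by (auto simp: bases_def)
  have "free (lines B)"
  proof (rule ccontr)
    assume "\<not> free (lines B)"
    then obtain C D where CD: "C \<in> Z" "D \<in> R"
      and on: "\<And>v. v \<in> V \<Longrightarrow> on_line (lines B v) (v \<in> C) (v \<in> D)" and ne: "\<not> (C = {} \<and> D = {})"
      by (elim not_freeE) blast
    have sub: "C \<subseteq> V" "D \<subseteq> V" using CD Z_sub R_sub by auto
    have "C \<subseteq> B" using on sub by (fastforce split: if_splits)
    then have "C = {}" using B(2)[OF CD(1) R_empty] by auto
    moreover have "D \<inter> B = {}" using on sub \<open>C = {}\<close> by (fastforce split: if_splits)
    ultimately show False using B(2)[OF CD] ne by auto
  qed
  then show "B \<in> odd_sets" using B(1) by (simp add: odd_sets_iff)
qed

text \<open>A pair that obstructs the flip at \<open>x\<close> cannot vanish there: zero lies on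
  every line, so the pair would also obstruct \<open>X\<close> itself.\<close>

lemma odd_sets_flip_or:
  assumes X: "X \<in> odd_sets" and x: "x \<in> V"
  obtains "sym_diff X {x} \<in> odd_sets"
  | C D where "C \<in> Z" "D \<in> R" "\<And>v. v \<in> V \<Longrightarrow> v \<noteq> x \<Longrightarrow> on_line (lines X v) (v \<in> C) (v \<in> D)"
    "on_line (lines (sym_diff X {x}) x) (x \<in> C) (x \<in> D)" "x \<in> C \<or> x \<in> D"
proof (cases "free (lines (sym_diff X {x}))")
  case True
  then show ?thesis using that(1) X x by (auto simp: odd_sets_iff)
next
  case False
  then obtain C D where CD: "C \<in> Z" "D \<in> R"
    "\<And>v. v \<in> V \<Longrightarrow> on_line (lines (sym_diff X {x}) v) (v \<in> C) (v \<in> D)" "\<not> (C = {} \<and> D = {})"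
    by (elim not_freeE) blast
  have off: "on_line (lines X v) (v \<in> C) (v \<in> D)" if "v \<in> V" "v \<noteq> x" for v
    using CD(3)[OF that(1)] that(2) by auto
  have "x \<in> C \<or> x \<in> D"
  proof (rule ccontr)
    assume no: "\<not> ?thesis"
    have "on_line (lines X v) (v \<in> C) (v \<in> D)" if "v \<in> V" for v
      using off[OF that] no by (cases "v = x") auto
    moreover have "free (lines X)" using X by (simp add: odd_sets_iff)
    ultimately show False using freeD CD by blast
  qed
  then show ?thesis using that(2)[OF CD(1,2) off CD(3)[OF x]] by blast
qed

text \<open>If flipping \<open>x\<close> alone is obstructed by a pair, freeness of \<open>Y\<close>
  yields an element \<open>y\<close> where that pair leaves the line of \<open>Y\<close>. Flipping
  \<open>y\<close> as well removes the obstruction, and isotropy excludes any new one.\<close>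

lemma odd_sets_exchange:
  assumes X: "X \<in> odd_sets" and Y: "Y \<in> odd_sets" and x: "x \<in> sym_diff X Y"
  shows "\<exists>y\<in>sym_diff X Y. sym_diff X {x, y} \<in> odd_sets"
proof -
  have XV: "X \<subseteq> V" "Y \<subseteq> V" and freeX: "free (lines X)" and freeY: "free (lines Y)"
    using X Y by (auto simp: odd_sets_iff)
  have xV: "x \<in> V" using x XV by auto
  show ?thesis
  proof (rule odd_sets_flip_or[OF X xV])
    assume "sym_diff X {x} \<in> odd_sets"
    then show ?thesis using x by (intro bexI[of _ x]) auto
  next
    fix C D assume CD: "C \<in> Z" "D \<in> R"
      and off: "\<And>v. v \<in> V \<Longrightarrow> v \<noteq> x \<Longrightarrow> on_line (lines X v) (v \<in> C) (v \<in> D)"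
      and at: "on_line (lines (sym_diff X {x}) x) (x \<in> C) (x \<in> D)" and nz: "x \<in> C \<or> x \<in> D"
    obtain y where y: "y \<in> V" "\<not> on_line (lines Y y) (y \<in> C) (y \<in> D)"
      using freeD[OF freeY CD] nz by blast
    have "y \<noteq> x"
    proof
      assume "y = x"
      moreover have "lines (sym_diff X {x}) x = lines Y x" using x by auto
      ultimately show False using at y(2) by simp
    qed
    have yXY: "y \<in> sym_diff X Y"
    proof (rule ccontr)
      assume "\<not> ?thesis"
      then have "lines X y = lines Y y" by auto
      then show False using off[OF y(1) \<open>y \<noteq> x\<close>] y(2) by simp
    qed
    have "free (lines (sym_diff X {x, y}))"
    proof (rule ccontr)
      assume "\<not> ?thesis"
      then obtain C' D' where CD': "C' \<in> Z" "D' \<in> R" "\<not> (C' = {} \<and> D' = {})"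
        and on: "\<And>v. v \<in> V \<Longrightarrow> on_line (lines (sym_diff X {x, y}) v) (v \<in> C') (v \<in> D')"
        by (elim not_freeE) blast
      have on': "on_line (lines X v) (v \<in> C') (v \<in> D')" if "v \<in> V" "v \<noteq> x" "v \<noteq> y" for v
        using on[OF that(1)] that(2,3) by auto
      have atx: "on_line (lines (sym_diff X {x}) x) (x \<in> C') (x \<in> D')"
        using on[OF xV] by auto
      have aty: "on_line (lines Y y) (y \<in> C') (y \<in> D')" using on[OF y(1)] yXY by auto
      have "(v \<in> C \<and> v \<in> D') = (v \<in> C' \<and> v \<in> D)" if "v \<in> V" "v \<noteq> y" for v
      proof (cases "v = x")
        case True
        then show ?thesis using on_line_isotropic[OF at atx] by simp
      next
        case False
        then show ?thesis using on_line_isotropic[OF off on'] that by blast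
      qed
      from isotropic_at[OF CD CD'(1,2) this]
      have "(y \<in> C \<and> y \<in> D') = (y \<in> C' \<and> y \<in> D)" .
      \<comment> \<open>At \<open>y\<close> the line of \<open>Y\<close> contains the value of the
        new pair but not that of the old one; as the two values are proportional, the new one is
        zero.\<close>
      with y(2) aty have y0: "y \<notin> C'" "y \<notin> D'" by (auto split: if_splits)
      have offx: "on_line (lines X v) (v \<in> C') (v \<in> D')" if "v \<in> V" "v \<noteq> x" for v
        using on'[OF that] y0 by (cases "v = y") auto
      have "x \<in> C' \<or> x \<in> D'"
      proof (rule ccontr)
        assume no: "\<not> ?thesis"
        have "on_line (lines X v) (v \<in> C') (v \<in> D')" if "v \<in> V" for v
          using offx[OF that] no by (cases "v = x") auto
        then show False using freeD[OF freeX CD'(1,2)] CD'(3) by blast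
      qed
      \<comment> \<open>Both values at \<open>x\<close> are nonzero and on the same line, hence
        equal. The sum of the pairs vanishes at \<open>x\<close> and so obeys the choice of
        \<open>X\<close> everywhere.\<close>
      with nz at atx have x_eq: "x \<in> C \<longleftrightarrow> x \<in> C'" "x \<in> D \<longleftrightarrow> x \<in> D'"
        by (auto split: if_splits)
      have "on_line (lines X v) (v \<in> sym_diff C C') (v \<in> sym_diff D D')" if "v \<in> V" for v
      proof (cases "v = x")
        case True
        then show ?thesis using x_eq by auto
      next
        case False
        then show ?thesis using on_line_sym_diff[OF off offx] that by blast
      qed
      then have "sym_diff C C' = {} \<and> sym_diff D D' = {}"
        using freeD[OF freeX Z_sym_diff[OF CD(1) CD'(1)] R_sym_diff[OF CD(2) CD'(2)]] by blast
      then have "C = C'" "D = D'" by auto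
      \<comment> \<open>The old pair is off a line at \<open>y\<close> and thus nonzero there,
        whereas the new one vanishes at \<open>y\<close>.\<close>
      with y(2) y0 show False by auto
    qed
    moreover have "sym_diff X {x, y} \<subseteq> V" using XV xV y(1) by auto
    ultimately have "sym_diff X {x, y} \<in> odd_sets" by (simp add: odd_sets_iff)
    then show ?thesis using yXY by blast
  qed
qed

lemma delta_matroid_odd_sets:
  assumes "bases \<noteq> {}"
  shows "delta_matroid (V, odd_sets)"
  unfolding delta_matroid_def set_system_def
  using fin assms bases_subset_odd_sets odd_sets_exchange by (auto simp: odd_sets_iff)

section \<open>Parity of the members\<close>

lemma odd_sets_no_flip:
  assumes even: "\<And>C. C \<in> Z \<Longrightarrow> even (card C)" and X: "X \<in> odd_sets" and x: "x \<in> V"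
  shows "sym_diff X {x} \<notin> odd_sets"
proof
  assume X': "sym_diff X {x} \<in> odd_sets"
  have "free (lines X)" using X by (simp add: odd_sets_iff)
  also have "lines X = (lines X)(x := lines X x)" by auto
  finally have fX: "free ((lines X)(x := lines X x))" .
  have "free (lines (sym_diff X {x}))" using X' by (simp add: odd_sets_iff)
  also have "lines (sym_diff X {x}) = (lines X)(x := lines (sym_diff X {x}) x)" by auto
  finally have "free ((lines X)(x := Third))" "free ((lines X)(x := Second))"
    using fX by (auto simp: fun_upd_def split: if_splits)
  \<comment> \<open>At most two of the three lines at \<open>x\<close> can be free, and
    \<open>Second\<close> and \<open>Third\<close> already are.\<close>
  then have "\<not> free ((lines X)(x := First))" using three_lines[OF x, of "lines X"] by blast
  then obtain C D where CD: "C \<in> Z" "D \<in> R" "\<not> (C = {} \<and> D = {})"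
    and on: "\<And>v. v \<in> V \<Longrightarrow> on_line (((lines X)(x := First)) v) (v \<in> C) (v \<in> D)"
    by (elim not_freeE) blast
  have off: "on_line (lines X v) (v \<in> C) (v \<in> D)" if "v \<in> V" "v \<noteq> x" for v
    using on[OF that(1)] that(2) by simp
  have at: "x \<notin> D" using on[OF x] by simp
  have sub: "C \<subseteq> V" using CD Z_sub by auto
  have xC: "x \<in> C"
  proof (rule ccontr)
    assume no: "x \<notin> C"
    have "on_line (lines X v) (v \<in> C) (v \<in> D)" if "v \<in> V" for v
      using off[OF that] no at by (cases "v = x") auto
    moreover have "free (lines X)" using X by (simp add: odd_sets_iff)
    ultimately show False using freeD CD by blast
  qed
  have "v \<in> D" if "v \<in> C" "v \<noteq> x" for v
    using off[of v] that sub by (auto split: if_splits)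
  \<comment> \<open>Away from \<open>x\<close> both \<open>Second\<close> and \<open>Third\<close>
    send elements of \<open>C\<close> into \<open>D\<close>, so \<open>x\<close> is the only element
    of \<open>C\<close> outside \<open>D\<close>. This makes \<open>C\<close> an odd member of
    \<open>Z\<close>.\<close>
  then have "C = insert x (C \<inter> D)" using xC by auto
  then have "card C = Suc (card (C \<inter> D))"
    using at finite_Z[OF CD(1)] by (metis IntD2 card_insert_disjoint finite_Int)
  then show False using even[OF CD(1)] orth[OF CD(1,2)] by simp
qed

text \<open>An exchange moves \<open>X\<close> towards \<open>Y\<close>. It changes exactly two
  elements, because \<open>odd_sets_no_flip\<close> rules out \<open>x = y\<close>, and so preserves
  parity.\<close>

lemma even_odd_sets_if:
  assumes even: "\<And>C. C \<in> Z \<Longrightarrow> even (card C)"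
  shows "even_set_system (V, odd_sets)"
proof -
  have "even (card X) \<longleftrightarrow> even (card Y)" if "X \<in> odd_sets" "Y \<in> odd_sets" for X Y
    using that
  proof (induction "card (sym_diff X Y)" arbitrary: X rule: less_induct)
    case less
    have XV: "X \<subseteq> V" "Y \<subseteq> V" using less.prems by (auto simp: odd_sets_iff)
    then have finXY: "finite X" "finite Y" using fin finite_subset by blast+
    show ?case
    proof (cases "X = Y")
      case False
      then obtain x where x: "x \<in> sym_diff X Y" by auto
      then obtain y where y: "y \<in> sym_diff X Y" "sym_diff X {x, y} \<in> odd_sets"
        using odd_sets_exchange[OF less.prems x] by blast
      have "x \<noteq> y" using odd_sets_no_flip[OF even less.prems(1), of x] x y XV by auto
      have "sym_diff (sym_diff X {x, y}) Y \<subset> sym_diff X Y" using x y by auto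
      then have "card (sym_diff (sym_diff X {x, y}) Y) < card (sym_diff X Y)"
        using finXY by (intro psubset_card_mono) auto
      from less.hyps[OF this y(2) less.prems(2)]
      show ?thesis using even_card_sym_diff[of X "{x, y}"] finXY \<open>x \<noteq> y\<close> by simp
    qed simp
  qed
  then show ?thesis unfolding even_set_system_def snd_conv by blast
qed

text \<open>For \<open>x\<close> outside \<open>B\<close>, the set \<open>insert x B\<close> has the
  wrong parity and is not free. The obstructing pair contains the fundamental cycle
  \<open>C'\<close> of \<open>x\<close>, and \<open>C' \<inter> D = C'\<close> makes it even.
  Subtracting such cycles moves \<open>C\<close> into \<open>B\<close>, where only the empty cycle
  is left.\<close>

lemma even_if_even_odd_sets:
  assumes B: "B \<in> bases" and ess: "even_set_system (V, odd_sets)" and C: "C \<in> Z"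
  shows "even (card C)"
  using C
proof (induction "card (C - B)" arbitrary: C rule: less_induct)
  case less
  have BV: "B \<subseteq> V" and freeB: "\<And>C D. C \<in> Z \<Longrightarrow> D \<in> R \<Longrightarrow> C \<subseteq> B \<Longrightarrow> D \<inter> B = {} \<Longrightarrow> C = {} \<and> D = {}"
    using B by (auto simp: bases_def)
  have finB: "finite B" using BV fin finite_subset by blast
  show ?case
  proof (cases "C \<subseteq> B")
    case True
    then show ?thesis using freeB[OF less.prems R_empty] by simp
  next
    case False
    then obtain x where x: "x \<in> C" "x \<notin> B" by auto
    then have xV: "x \<in> V" using less.prems Z_sub by auto
    have "B \<in> odd_sets" using B bases_subset_odd_sets by auto
    then have "insert x B \<notin> odd_sets" using ess x finB unfolding even_set_system_def by fastforce
    then have "\<not> free (lines (insert x B))" using xV BV by (simp add: odd_sets_iff)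
    then obtain C' D where CD: "C' \<in> Z" "D \<in> R" "\<not> (C' = {} \<and> D = {})"
      and on: "\<And>v. v \<in> V \<Longrightarrow> on_line (lines (insert x B) v) (v \<in> C') (v \<in> D)"
      by (elim not_freeE) blast
    have sub: "C' \<subseteq> V" "D \<subseteq> V" using CD Z_sub R_sub by auto
    have C': "C' \<subseteq> insert x B" using on sub by (fastforce split: if_splits)
    have C'D: "v \<in> C' \<longleftrightarrow> v \<in> D" if "v \<in> insert x B" for v
      using on[of v] that BV xV by auto
    have "x \<in> C'"
    proof (rule ccontr)
      assume "x \<notin> C'"
      then have "C' = {}" using C' freeB[OF CD(1) R_empty] by auto
      then have "D \<inter> B = {}" using C'D by auto
      then show False using freeB[OF CD(1,2)] \<open>C' = {}\<close> CD(3) by auto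
    qed
    have "C' \<inter> D = C'" using C' C'D by auto
    then have evC': "even (card C')" using orth[OF CD(1,2)] by simp
    have fins: "finite C" "finite C'" using finite_Z less.prems CD(1) by auto
    have "sym_diff C C' - B \<subset> C - B" using x \<open>x \<in> C'\<close> C' by auto
    then have "card (sym_diff C C' - B) < card (C - B)"
      using fins by (intro psubset_card_mono) auto
    then have "even (card (sym_diff C C'))"
      using less.hyps Z_sym_diff[OF less.prems CD(1)] by blast
    then show ?thesis using even_card_sym_diff[OF fins] evC' by simp
  qed
qed

lemma even_odd_sets_iff:
  assumes "bases \<noteq> {}"
  shows "even_set_system (V, odd_sets) \<longleftrightarrow> (\<forall>C\<in>Z. even (card C))"
  using assms even_odd_sets_if even_if_even_odd_sets by blast

section \<open>Duality\<close>

lemma swap: "orthogonal_pair V R Z"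
proof
  show "even (card (C \<inter> D))" if "C \<in> R" "D \<in> Z" for C D
    using orth[OF that(2,1)] by (simp add: Int_commute)
  show "2 ^ card V \<le> card R * card Z" using card_prod by (simp add: mult.commute)
qed (fact fin Z_sub R_sub Z_empty R_empty Z_sym_diff R_sym_diff)+

text \<open>Replacing \<open>W\<close> by its complement in \<open>V\<close> interchanges the
  conditions on \<open>C\<close> and \<open>D\<close>; this is the description of dual
  bases.\<close>

lemma bases_swap: "orthogonal_pair.bases V R Z = (\<lambda>B. V - B) ` bases"
proof -
  interpret s: orthogonal_pair V R Z by (rule swap)
  have iff: "V - W \<in> s.bases \<longleftrightarrow> W \<in> bases" if "W \<subseteq> V" for W
  proof -
    have eqs: "D \<subseteq> V - W \<longleftrightarrow> D \<inter> W = {}" "C \<inter> (V - W) = {} \<longleftrightarrow> C \<subseteq> W"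
      if "C \<in> Z" "D \<in> R" for C D
      using that Z_sub R_sub by blast+
    have "(\<forall>D\<in>R. \<forall>C\<in>Z. D \<subseteq> V - W \<and> C \<inter> (V - W) = {} \<longrightarrow> D = {} \<and> C = {}) \<longleftrightarrow>
      (\<forall>C\<in>Z. \<forall>D\<in>R. C \<subseteq> W \<and> D \<inter> W = {} \<longrightarrow> C = {} \<and> D = {})"
      using eqs by metis
    then show ?thesis unfolding s.bases_def bases_def using that by simp
  qed
  show ?thesis
  proof (intro equalityI subsetI)
    fix W assume W: "W \<in> s.bases"
    then have "W \<subseteq> V" by (auto simp: s.bases_def)
    then have "V - (V - W) = W" by auto
    then show "W \<in> (\<lambda>B. V - B) ` bases" using W iff[of "V - W"] by (intro image_eqI[of _ _ "V - W"]) auto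
  next
    fix W assume "W \<in> (\<lambda>B. V - B) ` bases"
    then show "W \<in> s.bases" using iff by (auto simp: bases_def)
  qed
qed

end

section \<open>Complementation\<close>

text \<open>Complementing in \<open>V\<close> leaves the symmetric difference of two members
  unchanged and commutes with flipping elements of \<open>V\<close>.\<close>

lemma delta_matroid_complement:
  assumes "delta_matroid (V, F)"
  shows "delta_matroid (V, (\<lambda>Y. V - Y) ` F)"
proof -
  have FV: "finite V" "F \<subseteq> Pow V" "F \<noteq> {}"
    and ex: "\<And>X Y x. X \<in> F \<Longrightarrow> Y \<in> F \<Longrightarrow> x \<in> sym_diff X Y \<Longrightarrow>
      \<exists>y\<in>sym_diff X Y. sym_diff X {x, y} \<in> F"
    using assms unfolding delta_matroid_def set_system_def by auto
  have "\<exists>y\<in>sym_diff (V - X) (V - Y). sym_diff (V - X) {x, y} \<in> (\<lambda>Y. V - Y) ` F"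
    if X: "X \<in> F" and Y: "Y \<in> F" and x: "x \<in> sym_diff (V - X) (V - Y)" for X Y x
  proof -
    have sub: "X \<subseteq> V" "Y \<subseteq> V" using X Y FV by auto
    have eq: "sym_diff (V - X) (V - Y) = sym_diff X Y" using sub by auto
    obtain y where y: "y \<in> sym_diff X Y" "sym_diff X {x, y} \<in> F"
      using ex[OF X Y] x unfolding eq by blast
    have "sym_diff (V - X) {x, y} = V - sym_diff X {x, y}" using sub x y(1) unfolding eq by auto
    then show ?thesis unfolding eq using y by blast
  qed
  then show ?thesis using FV unfolding delta_matroid_def set_system_def by auto
qed

lemma even_set_system_complement_iff:
  assumes "finite V" "F \<subseteq> Pow V"
  shows "even_set_system (V, (\<lambda>Y. V - Y) ` F) \<longleftrightarrow> even_set_system (V, F)"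
proof -
  have "even (card (V - Y)) \<longleftrightarrow> (even (card V) \<longleftrightarrow> even (card Y))" if "Y \<in> F" for Y
  proof -
    have "Y \<subseteq> V" using that assms(2) by auto
    then have "sym_diff V Y = V - Y" "finite Y" using assms(1) finite_subset by auto
    then show ?thesis using even_card_sym_diff[OF assms(1), of Y] by simp
  qed
  then show ?thesis unfolding even_set_system_def by auto
qed

section \<open>The cycle space of a binary matroid\<close>

text \<open>Over GF(2) a coefficient vector is the indicator of its support, so a linear dependency
  is a nonempty set of columns with sum zero.\<close>

lemma columns_lin_indep_iff:
  assumes "finite X"
  shows "columns_lin_indep r A X \<longleftrightarrow>
    (\<forall>C. C \<subseteq> X \<longrightarrow> (\<forall>i<r. (\<Sum>v\<in>C. A i v) = 0) \<longrightarrow> C = {})"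
proof
  assume indep: "columns_lin_indep r A X"
  show "\<forall>C. C \<subseteq> X \<longrightarrow> (\<forall>i<r. (\<Sum>v\<in>C. A i v) = 0) \<longrightarrow> C = {}"
  proof (intro allI impI)
    fix C assume C: "C \<subseteq> X" "\<forall>i<r. (\<Sum>v\<in>C. A i v) = 0"
    define c :: "'a \<Rightarrow> bit" where "c = (\<lambda>v. if v \<in> C then 1 else 0)"
    have "(\<Sum>v\<in>X. c v * A i v) = (\<Sum>v\<in>C. A i v)" for i
      using assms C(1) by (intro sum.mono_neutral_cong_right) (auto simp: c_def)
    then have "\<forall>v\<in>X. c v = 0" using indep C(2) unfolding columns_lin_indep_def by simp
    then show "C = {}" using C(1) by (auto simp: c_def split: if_splits)
  qed
next
  assume *: "\<forall>C. C \<subseteq> X \<longrightarrow> (\<forall>i<r. (\<Sum>v\<in>C. A i v) = 0) \<longrightarrow> C = {}"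
  show "columns_lin_indep r A X" unfolding columns_lin_indep_def
  proof (intro allI impI)
    fix c :: "'a \<Rightarrow> bit" assume c: "\<forall>i<r. (\<Sum>v\<in>X. c v * A i v) = 0"
    define C where "C = {v \<in> X. c v = 1}"
    have "(\<Sum>v\<in>X. c v * A i v) = (\<Sum>v\<in>C. A i v)" for i
      using assms by (intro sum.mono_neutral_cong_right) (auto simp: C_def)
    then have "\<forall>i<r. (\<Sum>v\<in>C. A i v) = 0" using c by simp
    moreover have "C \<subseteq> X" by (simp add: C_def)
    ultimately have "C = {}" using * by blast
    then show "\<forall>v\<in>X. c v = 0" by (auto simp: C_def)
  qed
qed

text \<open>The representing matrix enters only through its kernel \<open>Z\<close>, whose vectors
  are identified with their supports.\<close>

locale cycle_space =
  fixes M :: "'a set_system" and Z :: "'a set set"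
  assumes mat: "matroid M"
    and Z_sub: "Z \<subseteq> Pow (ground M)"
    and Z_empty: "{} \<in> Z"
    and Z_sym_diff: "A \<in> Z \<Longrightarrow> B \<in> Z \<Longrightarrow> sym_diff A B \<in> Z"
    and indep_iff: "X \<subseteq> ground M \<Longrightarrow> indep M X \<longleftrightarrow> (\<forall>C\<in>Z. C \<subseteq> X \<longrightarrow> C = {})"

lemma binary_matroid_cycle_space:
  assumes "binary_matroid M"
  shows "\<exists>Z. cycle_space M Z"
proof -
  obtain r A where mat: "matroid M"
    and A: "\<And>X. X \<subseteq> ground M \<Longrightarrow> indep M X \<longleftrightarrow> columns_lin_indep r A X"
    using assms unfolding binary_matroid_def by blast
  have fin: "finite (ground M)" using mat by (simp add: matroid_def set_system_def)
  define Z where "Z = {C. C \<subseteq> ground M \<and> (\<forall>i<r. (\<Sum>v\<in>C. A i v) = 0)}"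
  have "cycle_space M Z"
  proof
    show "sym_diff C D \<in> Z" if "C \<in> Z" "D \<in> Z" for C D
    proof -
      have "finite C" "finite D" using that fin by (auto simp: Z_def intro: finite_subset)
      then show ?thesis using that by (auto simp: Z_def sum_bit_sym_diff)
    qed
    show "indep M X \<longleftrightarrow> (\<forall>C\<in>Z. C \<subseteq> X \<longrightarrow> C = {})" if "X \<subseteq> ground M" for X
      unfolding A[OF that] columns_lin_indep_iff[OF finite_subset[OF that fin]] Z_def
      using that by blast
  qed (use mat in \<open>auto simp: Z_def\<close>)
  then show ?thesis by blast
qed

context cycle_space
begin

abbreviation V :: "'a set" where "V \<equiv> ground M"

section \<open>Fundamental cycles and cocycles\<close>

definition cocycles :: "'a set set" where
  "cocycles = {D. D \<subseteq> V \<and> (\<forall>C\<in>Z. even (card (C \<inter> D)))}"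

lemma finite_V: "finite V" using mat by (simp add: matroid_def set_system_def)

lemma finite_cycle: "C \<in> Z \<Longrightarrow> finite C" using Z_sub finite_V by (auto intro: finite_subset)

lemma base_subset: "B \<in> family M \<Longrightarrow> B \<subseteq> V" using mat by (auto simp: matroid_def set_system_def)

lemma base_indep: "B \<in> family M \<Longrightarrow> C \<in> Z \<Longrightarrow> C \<subseteq> B \<Longrightarrow> C = {}"
  using indep_iff[of B] base_subset by (auto simp: indep_def)

lemma base_antichain:
  assumes "B \<in> family M" "B' \<in> family M" "B \<subseteq> B'"
  shows "B = B'"
proof (rule ccontr)
  assume "B \<noteq> B'"
  then obtain x where "x \<in> B' - B" using assms by auto
  then have "\<exists>y\<in>B - B'. insert y (B' - {x}) \<in> family M"
    using mat assms unfolding matroid_def by blast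
  then show False using assms by auto
qed

text \<open>Bases are maximal independent sets, so \<open>insert v B\<close> contains a nonempty
  cycle, which must use \<open>v\<close> because \<open>B\<close> contains none.\<close>

lemma fundamental_cycle:
  assumes B: "B \<in> family M" and v: "v \<in> V - B"
  shows "\<exists>C\<in>Z. C - B = {v}"
proof -
  have "\<not> indep M (insert v B)"
    using base_antichain[OF B] v unfolding indep_def by auto
  then obtain C where C: "C \<in> Z" "C \<subseteq> insert v B" "C \<noteq> {}"
    using indep_iff[of "insert v B"] v base_subset[OF B] by auto
  then have "v \<in> C" using base_indep[OF B, of C] by auto
  then show ?thesis using C v by blast
qed

text \<open>Every cycle is the sum of the fundamental cycles of its elements outside
  \<open>B\<close>, so orthogonality has to be checked on those only.\<close>

lemma fundamental_cocycle:
  assumes B: "B \<in> family M" and u: "u \<in> B"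
  shows "\<exists>D\<in>cocycles. D \<inter> B = {u}"
proof -
  obtain f where f: "\<And>v. v \<in> V - B \<Longrightarrow> f v \<in> Z \<and> f v - B = {v}"
    using fundamental_cycle[OF B] by metis
  \<comment> \<open>The only candidate: orthogonality to \<open>f v\<close> decides whether
    \<open>v\<close> belongs to \<open>D\<close>.\<close>
  define D where "D = insert u {v \<in> V - B. u \<in> f v}"
  have "even (card (C \<inter> D))" if "C \<in> Z" for C
    using that
  proof (induction "card (C - B)" arbitrary: C rule: less_induct)
    case less
    show ?case
    proof (cases "C \<subseteq> B")
      case True
      then show ?thesis using base_indep[OF B less.prems] by simp
    next
      case False
      then obtain w where w: "w \<in> C" "w \<notin> B" by auto
      then have wV: "w \<in> V - B" using less.prems Z_sub by auto
      have fw: "f w \<in> Z" "f w - B = {w}" using f[OF wV] by auto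
      have fins: "finite C" "finite (f w)" using finite_cycle less.prems fw by auto
      have "sym_diff C (f w) - B \<subset> C - B" using w fw by auto
      then have "card (sym_diff C (f w) - B) < card (C - B)"
        using fins by (intro psubset_card_mono) auto
      then have "even (card (sym_diff C (f w) \<inter> D))"
        using less.hyps Z_sym_diff[OF less.prems fw(1)] by blast
      moreover have "sym_diff C (f w) \<inter> D = sym_diff (C \<inter> D) (f w \<inter> D)" by auto
      moreover have "even (card (f w \<inter> D))"
      proof -
        have sub: "f w \<subseteq> insert w B" "w \<in> f w" using fw(2) by blast+
        have D: "w \<in> D \<longleftrightarrow> u \<in> f w" "D \<inter> B = {u}" using wV u by (auto simp: D_def)
        have "f w \<inter> D = (if u \<in> f w then {u, w} else {})"
          using sub D by (cases "u \<in> f w") auto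
        moreover have "u \<noteq> w" using u w by auto
        ultimately show ?thesis by auto
      qed
      ultimately show ?thesis using even_card_sym_diff[of "C \<inter> D" "f w \<inter> D"] fins by simp
    qed
  qed
  then have "D \<in> cocycles" using u base_subset[OF B] by (auto simp: cocycles_def D_def)
  moreover have "D \<inter> B = {u}" using u by (auto simp: D_def)
  ultimately show ?thesis by blast
qed

lemma cocycles_sym_diff:
  assumes "D \<in> cocycles" "D' \<in> cocycles"
  shows "sym_diff D D' \<in> cocycles"
proof -
  have "even (card (C \<inter> sym_diff D D'))" if "C \<in> Z" for C
  proof -
    have "C \<inter> sym_diff D D' = sym_diff (C \<inter> D) (C \<inter> D')" by auto
    then show ?thesis
      using assms that finite_cycle[OF that] even_card_sym_diff[of "C \<inter> D" "C \<inter> D'"]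
      by (simp add: cocycles_def)
  qed
  then show ?thesis using assms by (auto simp: cocycles_def)
qed

lemma cycle_with_trace:
  assumes B: "B \<in> family M" and S: "S \<subseteq> V - B"
  shows "\<exists>C\<in>Z. C \<inter> (V - B) = S"
proof -
  have "\<exists>C\<in>Z. C \<inter> (V - B) = {v}" if "v \<in> V - B" for v
  proof -
    obtain C where C: "C \<in> Z" "C - B = {v}"
      using fundamental_cycle[OF B \<open>v \<in> V - B\<close>] by blast
    then have "C \<inter> (V - B) = C - B" using Z_sub by auto
    then show ?thesis using C by auto
  qed
  then show ?thesis
    using sym_diff_closed_trace[OF finite_Diff[OF finite_V] Z_empty Z_sym_diff _ S] by blast
qed

text \<open>For a base \<open>B\<close>, the cycles have all possible traces on \<open>V - B\<close>
  and the cocycles all possible traces on \<open>B\<close>; multiplying the two bounds gives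
  \<open>card_prod\<close>.\<close>

lemma orthogonal_pair: "orthogonal_pair V Z cocycles"
proof
  show "2 ^ card V \<le> card Z * card cocycles"
  proof -
    obtain B where B: "B \<in> family M" using mat by (auto simp: matroid_def)
    have BV: "B \<subseteq> V" "finite B" using base_subset[OF B] finite_V finite_subset by auto
    have finZR: "finite Z" "finite cocycles"
      using Z_sub finite_V by (auto simp: cocycles_def intro: finite_subset[of _ "Pow V"])
    have empty: "{} \<in> cocycles" by (simp add: cocycles_def)
    have trace: "\<exists>D\<in>cocycles. D \<inter> B = S" if "S \<subseteq> B" for S
      using sym_diff_closed_trace[OF BV(2) empty cocycles_sym_diff fundamental_cocycle[OF B] that]
      by blast
    have "2 ^ card (V - B) \<le> card Z"
      using card_trace_ge[OF finZR(1) _ cycle_with_trace[OF B]] finite_V by simp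
    moreover have "2 ^ card B \<le> card cocycles"
      using card_trace_ge[OF finZR(2) BV(2) trace] .
    moreover have "card V = card (V - B) + card B"
      using BV finite_V by (simp add: card_Diff_subset card_mono)
    ultimately show ?thesis by (simp add: power_add mult_le_mono)
  qed
  show "cocycles \<subseteq> Pow V" "{} \<in> cocycles" by (auto simp: cocycles_def)
  show "even (card (C \<inter> D))" if "C \<in> Z" "D \<in> cocycles" for C D
    using that by (simp add: cocycles_def)
qed (fact finite_V Z_sub Z_empty Z_sym_diff cocycles_sym_diff)+

sublocale op: orthogonal_pair V Z cocycles by (rule orthogonal_pair)

text \<open>A nonempty cocycle that avoids a base would meet a fundamental cycle in one element.
  Conversely, a free set \<open>W\<close> is independent, and if it were properly inside a base, a
  fundamental cocycle of a missing element would avoid it.\<close>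

lemma family_eq_bases: "family M = op.bases"
proof (intro equalityI subsetI)
  fix B assume B: "B \<in> family M"
  have "C = {} \<and> D = {}" if CD: "C \<in> Z" "D \<in> cocycles" "C \<subseteq> B" "D \<inter> B = {}" for C D
  proof
    show "C = {}" using base_indep[OF B CD(1,3)] .
    show "D = {}"
    proof (rule ccontr)
      assume "D \<noteq> {}"
      then obtain v where v: "v \<in> D" by auto
      then have "v \<in> V - B" using CD by (auto simp: cocycles_def)
      then obtain C' where C': "C' \<in> Z" "C' - B = {v}" using fundamental_cycle[OF B] by blast
      then have "C' \<inter> D = {v}" using v CD(4) by auto
      then show False using op.orth[OF C'(1) CD(2)] by simp
    qed
  qed
  then show "B \<in> op.bases" using base_subset[OF B] by (auto simp: op.bases_def)
next
  fix W assume "W \<in> op.bases"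
  then have WV: "W \<subseteq> V"
    and W: "\<And>C D. C \<in> Z \<Longrightarrow> D \<in> cocycles \<Longrightarrow> C \<subseteq> W \<Longrightarrow> D \<inter> W = {} \<Longrightarrow> C = {} \<and> D = {}"
    by (auto simp: op.bases_def)
  have "indep M W" using indep_iff[OF WV] W op.R_empty by auto
  then obtain B where B: "B \<in> family M" "W \<subseteq> B" by (auto simp: indep_def)
  have "W = B"
  proof (rule ccontr)
    assume "W \<noteq> B"
    then obtain u where u: "u \<in> B" "u \<notin> W" using B by auto
    obtain D where "D \<in> cocycles" "D \<inter> B = {u}" using fundamental_cocycle[OF B(1) u(1)] by blast
    moreover from this have "D \<inter> W = {}" using B(2) u(2) by auto
    ultimately show False using W[OF Z_empty] by auto
  qed
  then show "W \<in> family M" using B by simp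
qed

section \<open>Circuits and cycles\<close>

lemma circuit_cycle:
  assumes "circuit M C"
  shows "C \<in> Z"
proof -
  obtain C' where C': "C' \<in> Z" "C' \<subseteq> C" "C' \<noteq> {}"
    using assms indep_iff[of C] by (auto simp: circuit_def)
  have "C' = C"
  proof (rule ccontr)
    assume "C' \<noteq> C"
    then have "indep M C'" using assms C' by (auto simp: circuit_def)
    then show False using indep_iff[of C'] C' Z_sub by auto
  qed
  then show ?thesis using C' by simp
qed

lemma circuit_nonempty:
  assumes "circuit M C"
  shows "C \<noteq> {}"
  using assms indep_iff[of C] by (auto simp: circuit_def)

lemma cycle_contains_circuit:
  assumes "C \<in> Z" "C \<noteq> {}"
  obtains C' where "circuit M C'" "C' \<subseteq> C"
proof -
  let ?P = "\<lambda>X. X \<subseteq> C \<and> \<not> indep M X"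
  have CV: "C \<subseteq> V" using assms Z_sub by auto
  have "?P C" using assms indep_iff[OF CV] by auto
  then obtain X where X: "?P X" "\<And>Y. ?P Y \<Longrightarrow> card X \<le> card Y"
    using ex_has_least_nat[of ?P C card] by blast
  have "finite X" using X(1) finite_cycle[OF assms(1)] finite_subset by auto
  then have "indep M Y" if "Y \<subset> X" for Y
    using X that psubset_card_mono[of X Y] by (meson leD order_trans psubset_imp_subset)
  then have "circuit M X" using X(1) CV by (auto simp: circuit_def)
  then show ?thesis using that X(1) by blast
qed

text \<open>Removing a circuit from a cycle that contains it is addition over GF(2), so a smaller
  cycle remains.\<close>

lemma cycle_decomposition:
  assumes "C \<in> Z"
  shows "\<exists>\<C>. (\<forall>C'\<in>\<C>. circuit M C') \<and> pairwise disjnt \<C> \<and> \<Union>\<C> = C"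
  using assms
proof (induction "card C" arbitrary: C rule: less_induct)
  case less
  show ?case
  proof (cases "C = {}")
    case True
    then show ?thesis by (intro exI[of _ "{}"]) auto
  next
    case False
    then obtain C' where C': "circuit M C'" "C' \<subseteq> C"
      using cycle_contains_circuit less.prems by blast
    have "sym_diff C C' = C - C'" using C'(2) by auto
    then have "C - C' \<in> Z" using Z_sym_diff[OF less.prems circuit_cycle[OF C'(1)]] by simp
    moreover have "card (C - C') < card C"
      using circuit_nonempty[OF C'(1)] C'(2) finite_cycle[OF less.prems]
      by (intro psubset_card_mono) auto
    ultimately have "\<exists>\<C>. (\<forall>C'\<in>\<C>. circuit M C') \<and> pairwise disjnt \<C> \<and> \<Union>\<C> = C - C'"
      using less.hyps[of "C - C'"] by simp
    then obtain \<C> where \<C>: "\<forall>C'\<in>\<C>. circuit M C'" "pairwise disjnt \<C>" "\<Union>\<C> = C - C'"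
      by (elim exE conjE)
    have "disjnt C' K" "disjnt K C'" if "K \<in> \<C>" for K
      using \<C>(3) that by (auto simp: disjnt_def)
    then have "pairwise disjnt (insert C' \<C>)"
      using \<C>(2) by (simp add: pairwise_insert)
    moreover have "\<Union>(insert C' \<C>) = C" using \<C>(3) C'(2) by auto
    ultimately show ?thesis using \<C>(1) C'(1) by (intro exI[of _ "insert C' \<C>"]) simp
  qed
qed

lemma disjoint_cycles_Union:
  assumes "finite \<C>" "\<C> \<subseteq> Z" "pairwise disjnt \<C>"
  shows "\<Union>\<C> \<in> Z"
  using assms
proof (induction \<C>)
  case empty
  then show ?case using Z_empty by simp
next
  case (insert C \<C>)
  then have "\<Union>\<C> \<in> Z" "C \<in> Z" by (auto simp: pairwise_insert)
  moreover have "C \<inter> \<Union>\<C> = {}" using insert by (auto simp: pairwise_insert disjnt_def)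
  then have "sym_diff C (\<Union>\<C>) = \<Union>(insert C \<C>)" by auto
  ultimately show ?case using Z_sym_diff by metis
qed

lemma bipartite_iff: "bipartite_matroid M \<longleftrightarrow> (\<forall>C\<in>Z. even (card C))"
proof
  assume bip: "bipartite_matroid M"
  show "\<forall>C\<in>Z. even (card C)"
  proof
    fix C assume C: "C \<in> Z"
    obtain \<C> where \<C>: "\<forall>C'\<in>\<C>. circuit M C'" "pairwise disjnt \<C>" "\<Union>\<C> = C"
      using cycle_decomposition[OF C] by blast
    have "card C = sum card \<C>"
      using \<C> finite_cycle circuit_cycle by (metis card_Union_disjoint)
    moreover have "even (sum card \<C>)"
      using bip \<C>(1) unfolding bipartite_matroid_def by (intro dvd_sum) auto
    ultimately show "even (card C)" by simp
  qed
next
  assume "\<forall>C\<in>Z. even (card C)"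
  then show "bipartite_matroid M" using circuit_cycle by (auto simp: bipartite_matroid_def)
qed

lemma eulerian_iff: "eulerian_matroid M \<longleftrightarrow> V \<in> Z"
proof
  assume "eulerian_matroid M"
  then obtain \<C> where \<C>: "\<forall>C\<in>\<C>. circuit M C" "pairwise disjnt \<C>" "\<Union>\<C> = V"
    unfolding eulerian_matroid_def by (elim exE conjE)
  then have "finite \<C>" using finite_V finite_UnionD by metis
  then show "V \<in> Z" using disjoint_cycles_Union[of \<C>] \<C> circuit_cycle by auto
next
  assume "V \<in> Z"
  then show "eulerian_matroid M" using cycle_decomposition by (simp add: eulerian_matroid_def)
qed

text \<open>For the converse, a cycle that contains all of \<open>V - B\<close> is shown to be
  \<open>V\<close>: a missing \<open>u\<close> would be the only element of its fundamental cocycle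
  outside the cycle, making that cocycle odd.\<close>

lemma ground_cycle_iff: "V \<in> Z \<longleftrightarrow> (\<forall>D\<in>cocycles. even (card D))"
proof
  assume V: "V \<in> Z"
  show "\<forall>D\<in>cocycles. even (card D)"
  proof
    fix D assume D: "D \<in> cocycles"
    then have "V \<inter> D = D" by (auto simp: cocycles_def)
    then show "even (card D)" using op.orth[OF V D] by simp
  qed
next
  assume ev: "\<forall>D\<in>cocycles. even (card D)"
  obtain B where B: "B \<in> family M" using mat by (auto simp: matroid_def)
  obtain C where C: "C \<in> Z" "C \<inter> (V - B) = V - B" using cycle_with_trace[OF B] by blast
  have "u \<in> C" if u: "u \<in> B" for u
  proof (rule ccontr)
    assume "u \<notin> C"
    obtain D where D: "D \<in> cocycles" "D \<inter> B = {u}" using fundamental_cocycle[OF B u] by blast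
    then have DV: "D \<subseteq> V" "finite D" using finite_V finite_subset by (auto simp: cocycles_def)
    have "D = insert u (C \<inter> D)" using D(2) DV C(2) by blast
    then have "card D = Suc (card (C \<inter> D))"
      using \<open>u \<notin> C\<close> DV(2) by (metis IntD1 card_insert_disjoint finite_Int)
    moreover have "even (card D)" using ev D(1) by blast
    ultimately show False using op.orth[OF C(1) D(1)] by simp
  qed
  then have "C = V" using C Z_sub by blast
  then show "V \<in> Z" using C(1) by simp
qed

section \<open>Loop complement and dual pivot by the ground set\<close>

lemma loop_complement_ground: "loop_complement M V = (V, op.odd_sets)"
proof -
  have "{W \<in> family M. Y - V \<subseteq> W \<and> W \<subseteq> Y} = {W \<in> op.bases. W \<subseteq> Y}" if "Y \<subseteq> V" for Y
    using that family_eq_bases by auto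
  then show ?thesis by (auto simp: loop_complement_def op.odd_sets_def)
qed

text \<open>Complements turn \<open>Y \<subseteq> W\<close> into
  \<open>V - W \<subseteq> V - Y\<close>, and by \<open>bases_swap\<close> the sets
  \<open>V - W\<close> are the bases of the swapped pair.\<close>

lemma dual_pivot_ground:
  "dual_pivot M V = (V, (\<lambda>Y. V - Y) ` orthogonal_pair.odd_sets V cocycles Z)"
proof -
  interpret s: orthogonal_pair V cocycles Z by (rule op.swap)
  have iff: "odd (card {W \<in> family M. Y \<subseteq> W}) \<longleftrightarrow> V - Y \<in> s.odd_sets" if "Y \<subseteq> V" for Y
  proof -
    have "inj_on (\<lambda>W. V - W) {W \<in> family M. Y \<subseteq> W}"
      using base_subset by (intro inj_onI) blast
    then have "card {W \<in> family M. Y \<subseteq> W} = card ((\<lambda>W. V - W) ` {W \<in> family M. Y \<subseteq> W})"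
      by (simp add: card_image)
    also have "(\<lambda>W. V - W) ` {W \<in> family M. Y \<subseteq> W} = {W \<in> s.bases. W \<subseteq> V - Y}"
      using base_subset that unfolding op.bases_swap family_eq_bases by blast
    finally show ?thesis by (simp add: s.odd_sets_def)
  qed
  have sub: "Y \<subseteq> V" if "Y \<in> s.odd_sets" for Y using that by (simp add: s.odd_sets_def)
  have "{Y. Y \<subseteq> V \<and> odd (card {W \<in> family M. Y \<subseteq> W \<and> W \<subseteq> Y \<union> V})} =
    {Y. Y \<subseteq> V \<and> odd (card {W \<in> family M. Y \<subseteq> W})}"
  proof -
    have "{W \<in> family M. Y \<subseteq> W \<and> W \<subseteq> Y \<union> V} = {W \<in> family M. Y \<subseteq> W}" for Y
      using base_subset by blast
    then show ?thesis by simp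
  qed
  also have "\<dots> = (\<lambda>Y. V - Y) ` s.odd_sets"
  proof (intro equalityI subsetI)
    fix Y assume "Y \<in> {Y. Y \<subseteq> V \<and> odd (card {W \<in> family M. Y \<subseteq> W})}"
    then show "Y \<in> (\<lambda>Y. V - Y) ` s.odd_sets"
      using iff[of Y] by (intro image_eqI[of _ _ "V - Y"]) auto
  next
    fix Y assume "Y \<in> (\<lambda>Y. V - Y) ` s.odd_sets"
    then obtain Y' where Y': "Y' \<in> s.odd_sets" "Y = V - Y'" by auto
    then have "V - Y = Y'" using sub by blast
    then show "Y \<in> {Y. Y \<subseteq> V \<and> odd (card {W \<in> family M. Y \<subseteq> W})}" using iff[of Y] Y' by auto
  qed
  finally show ?thesis by (simp add: dual_pivot_def)
qed

text \<open>The \<Delta>-matroid property holds for every binary matroid, so only evenness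
  distinguishes the bipartite ones.\<close>

lemma bipartite_iff_loop_complement:
  "bipartite_matroid M \<longleftrightarrow>
    even_set_system (loop_complement M V) \<and> delta_matroid (loop_complement M V)"
proof -
  have "op.bases \<noteq> {}" using mat family_eq_bases by (simp add: matroid_def)
  then show ?thesis
    by (simp add: loop_complement_ground bipartite_iff op.even_odd_sets_iff
        op.delta_matroid_odd_sets)
qed

lemma eulerian_iff_dual_pivot:
  "eulerian_matroid M \<longleftrightarrow>
    even_set_system (dual_pivot M V) \<and> delta_matroid (dual_pivot M V)"
proof -
  interpret s: orthogonal_pair V cocycles Z by (rule op.swap)
  have ne: "s.bases \<noteq> {}"
    using mat family_eq_bases unfolding op.bases_swap by (simp add: matroid_def)
  have "s.odd_sets \<subseteq> Pow V" by (auto simp: s.odd_sets_def)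
  then show ?thesis
    by (simp add: dual_pivot_ground eulerian_iff ground_cycle_iff finite_V
        even_set_system_complement_iff s.even_odd_sets_iff[OF ne]
        delta_matroid_complement[OF s.delta_matroid_odd_sets[OF ne]])
qed

end

theorem theorem5:
  fixes M :: "'a set_system" and V :: "'a set"
  assumes "binary_matroid M" and "ground M = V"
  shows "(bipartite_matroid M \<longleftrightarrow>
            even_set_system (loop_complement M V) \<and> delta_matroid (loop_complement M V)) \<and>
         (eulerian_matroid M \<longleftrightarrow>
            even_set_system (dual_pivot M V) \<and> delta_matroid (dual_pivot M V))"
proof -
  obtain Z where "cycle_space M Z" using binary_matroid_cycle_space[OF assms(1)] by blast
  then interpret cycle_space M Z .
  show ?thesis
    using bipartite_iff_loop_complement eulerian_iff_dual_pivot unfolding assms(2) by blast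
qed

end
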